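(* Let $n \in \mathbb{N}$. For any $\vec{p} = (p_1, \dots, p_n) \in \mathbb{N}^n$, with $|\vec{p}| = p_1 + 2p_2 + \cdots + n p_n$, there is an equivalence of groupoids \[ \mathsf{C}_{\vec{p}} \simeq \mathsf{Perm}_{n - |\vec{p}|} \; \times \; \prod_{k = 1}^n \mathsf{B}(\mathbb{Z}/k)^{p_k}. \]
   Context: Here $\mathbb{N}$ includes $0$. For an integer $m \geq 0$, $\mathsf{Perm}_m$ is the groupoid in which an object is an $m$-element set $X$ equipped with a permutation $\sigma \colon X \to X$, and a morphism from $\sigma \colon X \to X$ to $\sigma' \colon X' \to X'$ is a bijection $f \colon X \to X'$ that is permutation-preserving, meaning $f \circ \sigma \circ f^{-1} = \sigma'$. If $m < 0$, $\mathsf{Perm}_m$ is the empty groupoid (no objects and no morphisms). A $k$-cycle of a permutation $\sigma$ is a cycle of $\sigma$ of length $k$ (a $1$-cycle is a fixed point); distinct cycles of $\sigma$ are automatically disjoint. For $\vec{p} = (p_1, \dots, p_n) \in \mathbb{N}^n$, $\mathsf{C}_{\vec{p}}$ is the groupoid of $n$-element sets $X$ equipped with a permutation $\sigma \colon X \to X$ that is in turn equipped with a choice of an ordered $p_1$-tuple of distinct $1$-cycles of $\sigma$, an ordered $p_2$-tuple of distinct $2$-cycles of $\sigma$, and so on up to an ordered $p_n$-tuple of distinct $n$-cycles of $\sigma$. A morphism in this groupoid is a bijection that is permutation-preserving and also preserves the ordered tuples of distinct cycles (the $i$th chosen $k$-cycle is sent to the $i$th chosen $k$-cycle). If $|\vec{p}|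 > n$ this groupoid is empty. For a group $G$, $\mathsf{B}(G)$ denotes its delooping: the groupoid with one object $\star$ and $\mathrm{Aut}(\star) = G$. Equivalence of groupoids means equivalence of categories. *)

theory Defs
  imports
    "HOL-Library.Infinite_Typeclass"
    "HOL-Combinatorics.Permutations"
    "HOL-Combinatorics.Orbits"
    "HOL-Algebra.Elementary_Groups"
begin

section \<open>Categories, groupoids and equivalences\<close>

text \<open>
  Hom-sets need not be disjoint, so identities, composition and the action of a functor on
  morphisms take the source and target objects as arguments: \<open>Comp C a b c g f\<close> is the composite
  of \<open>f \<in> Hom C a b\<close> and \<open>g \<in> Hom C b c\<close>.
\<close>

record ('o, 'm) cat =
  Obj :: "'o set"
  Hom :: "'o \<Rightarrow> 'o \<Rightarrow> 'm set"
  Id :: "'o \<Rightarrow> 'm"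
  Comp :: "'o \<Rightarrow> 'o \<Rightarrow> 'o \<Rightarrow> 'm \<Rightarrow> 'm \<Rightarrow> 'm"

definition is_category :: "('o, 'm) cat \<Rightarrow> bool" where
  "is_category C \<longleftrightarrow>
     (\<forall>a\<in>Obj C. Id C a \<in> Hom C a a) \<and>
     (\<forall>a\<in>Obj C. \<forall>b\<in>Obj C. \<forall>c\<in>Obj C. \<forall>f\<in>Hom C a b. \<forall>g\<in>Hom C b c.
        Comp C a b c g f \<in> Hom C a c) \<and>
     (\<forall>a\<in>Obj C. \<forall>b\<in>Obj C. \<forall>f\<in>Hom C a b.
        Comp C a a b f (Id C a) = f \<and> Comp C a b b (Id C b) f = f) \<and>
     (\<forall>a\<in>Obj C. \<forall>b\<in>Obj C. \<forall>c\<in>Obj C. \<forall>d\<in>Obj C.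
      \<forall>f\<in>Hom C a b. \<forall>g\<in>Hom C b c. \<forall>h\<in>Hom C c d.
        Comp C a c d h (Comp C a b c g f) = Comp C a b d (Comp C b c d h g) f)"

definition is_iso :: "('o, 'm) cat \<Rightarrow> 'o \<Rightarrow> 'o \<Rightarrow> 'm \<Rightarrow> bool" where
  "is_iso C a b f \<longleftrightarrow> f \<in> Hom C a b \<and>
     (\<exists>g\<in>Hom C b a. Comp C a b a g f = Id C a \<and> Comp C b a b f g = Id C b)"

definition is_groupoid :: "('o, 'm) cat \<Rightarrow> bool" where
  "is_groupoid C \<longleftrightarrow> is_category C \<and>
     (\<forall>a\<in>Obj C. \<forall>b\<in>Obj C. \<forall>f\<in>Hom C a b. is_iso C a b f)"

record ('o, 'm, 'p, 'n) funct =
  FObj :: "'o \<Rightarrow> 'p"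
  FMap :: "'o \<Rightarrow> 'o \<Rightarrow> 'm \<Rightarrow> 'n"

definition is_functor ::
  "('o, 'm) cat \<Rightarrow> ('p, 'n) cat \<Rightarrow> ('o, 'm, 'p, 'n) funct \<Rightarrow> bool" where
  "is_functor C D F \<longleftrightarrow>
     (\<forall>a\<in>Obj C. FObj F a \<in> Obj D) \<and>
     (\<forall>a\<in>Obj C. \<forall>b\<in>Obj C. \<forall>f\<in>Hom C a b. FMap F a b f \<in> Hom D (FObj F a) (FObj F b)) \<and>
     (\<forall>a\<in>Obj C. FMap F a a (Id C a) = Id D (FObj F a)) \<and>
     (\<forall>a\<in>Obj C. \<forall>b\<in>Obj C. \<forall>c\<in>Obj C. \<forall>f\<in>Hom C a b. \<forall>g\<in>Hom C b c.
        FMap F a c (Comp C a b c g f) =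
        Comp D (FObj F a) (FObj F b) (FObj F c) (FMap F b c g) (FMap F a b f))"

definition id_funct :: "('o, 'm, 'o, 'm) funct" where
  "id_funct = \<lparr>FObj = (\<lambda>a. a), FMap = (\<lambda>a b f. f)\<rparr>"

definition comp_funct ::
  "('p, 'n, 'q, 'l) funct \<Rightarrow> ('o, 'm, 'p, 'n) funct \<Rightarrow> ('o, 'm, 'q, 'l) funct" where
  "comp_funct G F =
     \<lparr>FObj = (\<lambda>a. FObj G (FObj F a)),
      FMap = (\<lambda>a b f. FMap G (FObj F a) (FObj F b) (FMap F a b f))\<rparr>"

definition is_nat_iso ::
  "('o, 'm) cat \<Rightarrow> ('p, 'n) cat \<Rightarrow> ('o, 'm, 'p, 'n) funct \<Rightarrow> ('o, 'm, 'p, 'n) funct \<Rightarrow>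
   ('o \<Rightarrow> 'n) \<Rightarrow> bool" where
  "is_nat_iso C D F G \<eta> \<longleftrightarrow>
     (\<forall>a\<in>Obj C. is_iso D (FObj F a) (FObj G a) (\<eta> a)) \<and>
     (\<forall>a\<in>Obj C. \<forall>b\<in>Obj C. \<forall>f\<in>Hom C a b.
        Comp D (FObj F a) (FObj F b) (FObj G b) (\<eta> b) (FMap F a b f) =
        Comp D (FObj F a) (FObj G a) (FObj G b) (FMap G a b f) (\<eta> a))"

definition equivalent_categories :: "('o, 'm) cat \<Rightarrow> ('p, 'n) cat \<Rightarrow> bool" where
  "equivalent_categories C D \<longleftrightarrow> is_category C \<and> is_category D \<and>
     (\<exists>F G \<eta> \<epsilon>. is_functor C D F \<and> is_functor D C G \<and>
        is_nat_iso C C id_funct (comp_funct G F) \<eta> \<and>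
        is_nat_iso D D (comp_funct F G) id_funct \<epsilon>)"

definition equivalent_groupoids :: "('o, 'm) cat \<Rightarrow> ('p, 'n) cat \<Rightarrow> bool" where
  "equivalent_groupoids C D \<longleftrightarrow> is_groupoid C \<and> is_groupoid D \<and> equivalent_categories C D"


section \<open>Products and deloopings\<close>

definition prod_cat :: "('o, 'm) cat \<Rightarrow> ('p, 'n) cat \<Rightarrow> ('o \<times> 'p, 'm \<times> 'n) cat" where
  "prod_cat C D =
     \<lparr>Obj = Obj C \<times> Obj D,
      Hom = (\<lambda>a b. Hom C (fst a) (fst b) \<times> Hom D (snd a) (snd b)),
      Id = (\<lambda>a. (Id C (fst a), Id D (snd a))),
      Comp = (\<lambda>a b c g f.
        (Comp C (fst a) (fst b) (fst c) (fst g) (fst f),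
         Comp D (snd a) (snd b) (snd c) (snd g) (snd f)))\<rparr>"

definition Prod_cat :: "'i set \<Rightarrow> ('i \<Rightarrow> ('o, 'm) cat) \<Rightarrow> ('i \<Rightarrow> 'o, 'i \<Rightarrow> 'm) cat" where
  "Prod_cat I C =
     \<lparr>Obj = (\<Pi>\<^sub>E i\<in>I. Obj (C i)),
      Hom = (\<lambda>a b. \<Pi>\<^sub>E i\<in>I. Hom (C i) (a i) (b i)),
      Id = (\<lambda>a. \<lambda>i\<in>I. Id (C i) (a i)),
      Comp = (\<lambda>a b c g f. \<lambda>i\<in>I. Comp (C i) (a i) (b i) (c i) (g i) (f i))\<rparr>"

definition power_cat :: "('o, 'm) cat \<Rightarrow> nat \<Rightarrow> (nat \<Rightarrow> 'o, nat \<Rightarrow> 'm) cat" where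
  "power_cat C r = Prod_cat {1..r} (\<lambda>_. C)"

definition delooping :: "('g, 'x) monoid_scheme \<Rightarrow> (unit, 'g) cat" where
  "delooping G =
     \<lparr>Obj = {()},
      Hom = (\<lambda>_ _. carrier G),
      Id = (\<lambda>_. \<one>\<^bsub>G\<^esub>),
      Comp = (\<lambda>_ _ _ g f. g \<otimes>\<^bsub>G\<^esub> f)\<rparr>"


section \<open>Groupoids of permutations\<close>

text \<open>
  The underlying sets are the finite subsets of a fixed type \<open>'a\<close>, which plays the role of the
  universe of sets; it has to be infinite so that there are sets of every finite cardinality.
  A permutation of \<open>X\<close> is represented by a function that is the identity outside \<open>X\<close>
  (\<^const>\<open>permutes\<close>), a map out of \<open>X\<close> by a function that is \<^const>\<open>undefined\<close> outside \<open>X\<close>.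
\<close>

definition perm_preserving ::
  "'a set \<Rightarrow> ('a \<Rightarrow> 'a) \<Rightarrow> 'a set \<Rightarrow> ('a \<Rightarrow> 'a) \<Rightarrow> ('a \<Rightarrow> 'a) set" where
  "perm_preserving X \<sigma> X' \<sigma>' =
     {f \<in> extensional X. bij_betw f X X' \<and> (\<forall>y\<in>X'. f (\<sigma> (inv_into X f y)) = \<sigma>' y)}"

text \<open>For negative \<open>m\<close> there are no objects.\<close>

definition Perm :: "int \<Rightarrow> ('a set \<times> ('a \<Rightarrow> 'a), 'a \<Rightarrow> 'a) cat" where
  "Perm m =
     \<lparr>Obj = {(X, \<sigma>). finite X \<and> int (card X) = m \<and> \<sigma> permutes X},
      Hom = (\<lambda>(X, \<sigma>) (X', \<sigma>'). perm_preserving X \<sigma> X' \<sigma>'),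
      Id = (\<lambda>(X, \<sigma>). \<lambda>x\<in>X. x),
      Comp = (\<lambda>(X, \<sigma>) _ _ g f. compose X g f)\<rparr>"

text \<open>
  A cycle of \<open>\<sigma>\<close> is represented by its set of elements, an orbit of \<open>\<sigma>\<close>; the cyclic order is
  determined by \<open>\<sigma>\<close>.
\<close>

definition cycles_of_length :: "'a set \<Rightarrow> ('a \<Rightarrow> 'a) \<Rightarrow> nat \<Rightarrow> 'a set set" where
  "cycles_of_length X \<sigma> k = {c. \<exists>x\<in>X. c = orbit \<sigma> x \<and> card c = k}"

text \<open>
  Only the values \<open>p 1, \<dots>, p n\<close> of \<open>p\<close> are used; they form the tuple in \<open>\<nat>\<^sup>n\<close>. In an object
  \<open>(X, \<sigma>, c)\<close>, the list \<open>c k\<close> is the chosen ordered tuple of distinct \<open>k\<close>-cycles.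
\<close>

definition cycle_groupoid ::
  "nat \<Rightarrow> (nat \<Rightarrow> nat) \<Rightarrow> ('a set \<times> ('a \<Rightarrow> 'a) \<times> (nat \<Rightarrow> 'a set list), 'a \<Rightarrow> 'a) cat" where
  "cycle_groupoid n p =
     \<lparr>Obj = {(X, \<sigma>, c). finite X \<and> card X = n \<and> \<sigma> permutes X \<and>
        c \<in> (\<Pi>\<^sub>E k\<in>{1..n}. {cs. length cs = p k \<and> distinct cs \<and> set cs \<subseteq> cycles_of_length X \<sigma> k})},
      Hom = (\<lambda>(X, \<sigma>, c) (X', \<sigma>', c').
        {f \<in> perm_preserving X \<sigma> X' \<sigma>'. \<forall>k\<in>{1..n}. map (\<lambda>C. f ` C) (c k) = c' k}),
      Id = (\<lambda>(X, \<sigma>, c). \<lambda>x\<in>X. x),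
      Comp = (\<lambda>(X, \<sigma>, c) _ _ g f. compose X g f)\<rparr>"

definition weight :: "nat \<Rightarrow> (nat \<Rightarrow> nat) \<Rightarrow> nat" where
  "weight n p = (\<Sum>k = 1..n. k * p k)"

end

theory Submission
  imports Defs
begin

text \<open>
  Removing the chosen cycles leaves a permutation of a set of \<open>n - |p|\<close> elements. A base point in
  every chosen cycle turns the \<open>i\<close>-th chosen \<open>k\<close>-cycle into a copy of \<open>\<int>/k\<close> on which the permutation
  acts as the successor, so that a morphism acts on it as a shift by some element of \<open>\<int>/k\<close>. Sending
  a morphism to its restriction to the remaining points together with all these shifts is a fully
  faithful functor. It is surjective on objects, since the universe is infinite and hence has room
  for the missing cycles.
\<close>


section \<open>Groupoids\<close>

text \<open>A bijection between two \<open>k\<close>-cycles that commutes with the permutations is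
  fixed by the image of a single point, and each of the \<open>k\<close> points of the target can be
  that image. This is where Z/k comes from, once a point of each cycle serves as zero. The zeros are
  picked separately in every object, with no compatibility between objects. Functoriality survives
  because a shift is measured from the zero in the source to the zero in the target, so the zeros of
  an intermediate object cancel in a composite.

  The points of the chosen cycles are counted by triples (length, position in the tuple, residue),
  of which there are \<open>weight n p\<close>. They lie in a set of \<open>n\<close> elements, so
  there is no object when the weight exceeds \<open>n\<close>; the target is then empty too, and no
  case distinction arises. Hitting every object on the nose, and not just up to isomorphism, lets
  the counit of the equivalence be the identity.\<close>

lemma category_Id: "is_category C \<Longrightarrow> a \<in> Obj C \<Longrightarrow> Id C a \<in> Hom C a a"
  by (simp add: is_category_def)

lemma category_Comp:
  "is_category C \<Longrightarrow> a \<in> Obj C \<Longrightarrow> b \<in> Obj C \<Longrightarrow> c \<in> Obj C \<Longrightarrow> f \<in> Hom C a b \<Longrightarrow> g \<in> Hom C b c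
    \<Longrightarrow> Comp C a b c g f \<in> Hom C a c"
  unfolding is_category_def by blast

lemma category_Id_right:
  "is_category C \<Longrightarrow> a \<in> Obj C \<Longrightarrow> b \<in> Obj C \<Longrightarrow> f \<in> Hom C a b \<Longrightarrow> Comp C a a b f (Id C a) = f"
  unfolding is_category_def by blast

lemma category_Id_left:
  "is_category C \<Longrightarrow> a \<in> Obj C \<Longrightarrow> b \<in> Obj C \<Longrightarrow> f \<in> Hom C a b \<Longrightarrow> Comp C a b b (Id C b) f = f"
  unfolding is_category_def by blast

lemma category_assoc:
  "is_category C \<Longrightarrow> a \<in> Obj C \<Longrightarrow> b \<in> Obj C \<Longrightarrow> c \<in> Obj C \<Longrightarrow> d \<in> Obj C \<Longrightarrow>
    f \<in> Hom C a b \<Longrightarrow> g \<in> Hom C b c \<Longrightarrow> h \<in> Hom C c d \<Longrightarrow>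
    Comp C a c d h (Comp C a b c g f) = Comp C a b d (Comp C b c d h g) f"
  unfolding is_category_def by blast

lemma groupoid_category: "is_groupoid C \<Longrightarrow> is_category C"
  by (simp add: is_groupoid_def)

lemma groupoid_iso: "is_groupoid C \<Longrightarrow> a \<in> Obj C \<Longrightarrow> b \<in> Obj C \<Longrightarrow> f \<in> Hom C a b \<Longrightarrow> is_iso C a b f"
  unfolding is_groupoid_def by blast

lemma functor_Obj: "is_functor C D F \<Longrightarrow> a \<in> Obj C \<Longrightarrow> FObj F a \<in> Obj D"
  by (simp add: is_functor_def)

lemma functor_Hom:
  "is_functor C D F \<Longrightarrow> a \<in> Obj C \<Longrightarrow> b \<in> Obj C \<Longrightarrow> f \<in> Hom C a b
    \<Longrightarrow> FMap F a b f \<in> Hom D (FObj F a) (FObj F b)"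
  unfolding is_functor_def by blast

lemma functor_Id: "is_functor C D F \<Longrightarrow> a \<in> Obj C \<Longrightarrow> FMap F a a (Id C a) = Id D (FObj F a)"
  by (simp add: is_functor_def)

lemma functor_Comp:
  "is_functor C D F \<Longrightarrow> a \<in> Obj C \<Longrightarrow> b \<in> Obj C \<Longrightarrow> c \<in> Obj C \<Longrightarrow> f \<in> Hom C a b \<Longrightarrow> g \<in> Hom C b c
    \<Longrightarrow> FMap F a c (Comp C a b c g f)
      = Comp D (FObj F a) (FObj F b) (FObj F c) (FMap F b c g) (FMap F a b f)"
  unfolding is_functor_def by blast

text \<open>The inverse functor picks a preimage of each object and lifts morphisms through the
  bijections on hom-sets. Every equation about it is checked after applying \<open>F\<close>, where
  the lifts disappear, and faithfulness carries it back.\<close>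

theorem equivalent_groupoidsI:
  assumes C: "is_groupoid C" and D: "is_groupoid D" and F: "is_functor C D F"
    and ff: "\<And>a b. a \<in> Obj C \<Longrightarrow> b \<in> Obj C \<Longrightarrow>
      bij_betw (FMap F a b) (Hom C a b) (Hom D (FObj F a) (FObj F b))"
    and surj: "Obj D \<subseteq> FObj F ` Obj C"
  shows "equivalent_groupoids C D"
proof -
  note CC = groupoid_category[OF C] and DD = groupoid_category[OF D]
  define g where "g = inv_into (Obj C) (FObj F)"
  have g: "g d \<in> Obj C" "FObj F (g d) = d" if "d \<in> Obj D" for d
    using that surj unfolding g_def by (auto intro: inv_into_into f_inv_into_f)
  have gF: "g (FObj F a) \<in> Obj C" "FObj F (g (FObj F a)) = FObj F a" if "a \<in> Obj C" for a
    using g[OF functor_Obj[OF F that]] by auto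
  define lift where "lift a b = inv_into (Hom C a b) (FMap F a b)" for a b
  have lift_Hom: "lift a b h \<in> Hom C a b" and F_lift: "FMap F a b (lift a b h) = h"
    if "a \<in> Obj C" "b \<in> Obj C" "h \<in> Hom D (FObj F a) (FObj F b)" for a b h
    using ff[OF that(1,2)] that(3) unfolding lift_def bij_betw_def
    by (auto intro: inv_into_into f_inv_into_f)
  have faithful: "f = f'"
    if "FMap F a b f = FMap F a b f'" "a \<in> Obj C" "b \<in> Obj C" "f \<in> Hom C a b" "f' \<in> Hom C a b"
    for a b f f'
    using bij_betw_imp_inj_on[OF ff[OF that(2,3)]] that by (auto dest: inj_onD)
  define G where "G = \<lparr>FObj = g, FMap = (\<lambda>d d' h. lift (g d) (g d') h)\<rparr>"
  \<comment> \<open>\<open>F\<close> sends \<open>g (FObj F a)\<close> to \<open>FObj F a\<close>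
    again, so the identity there is a morphism that can be lifted to one from \<open>a\<close> to
    \<open>g (FObj F a)\<close>.\<close>
  define \<eta> where "\<eta> a = lift a (g (FObj F a)) (Id D (FObj F a))" for a
  have G: "is_functor D C G"
    unfolding is_functor_def
  proof (intro conjI ballI)
    fix a assume a: "a \<in> Obj D"
    show "FObj G a \<in> Obj C" using g[OF a] by (simp add: G_def)
    show "FMap G a a (Id D a) = Id C (FObj G a)"
      by (rule faithful[of "g a" "g a"])
        (simp_all add: G_def g a F_lift lift_Hom category_Id[OF CC] category_Id[OF DD] functor_Id[OF F])
  next
    fix a b f assume "a \<in> Obj D" "b \<in> Obj D" "f \<in> Hom D a b"
    then show "FMap G a b f \<in> Hom C (FObj G a) (FObj G b)"
      by (simp add: G_def lift_Hom g)
  next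
    fix a b c f h assume *: "a \<in> Obj D" "b \<in> Obj D" "c \<in> Obj D" "f \<in> Hom D a b" "h \<in> Hom D b c"
    then show "FMap G a c (Comp D a b c h f)
      = Comp C (FObj G a) (FObj G b) (FObj G c) (FMap G b c h) (FMap G a b f)"
      by (intro faithful[of "g a" "g c"])
        (simp_all add: G_def g F_lift lift_Hom category_Comp[OF CC, where b = "g b"]
          category_Comp[OF DD, where b = b] functor_Comp[OF F])
  qed
  have \<eta>: "\<eta> a \<in> Hom C a (g (FObj F a))" "FMap F a (g (FObj F a)) (\<eta> a) = Id D (FObj F a)"
    if "a \<in> Obj C" for a
    using that category_Id[OF DD functor_Obj[OF F that]]
    by (simp_all add: \<eta>_def lift_Hom F_lift gF)
  have \<eta>_iso: "is_nat_iso C C id_funct (comp_funct G F) \<eta>"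
    unfolding is_nat_iso_def
  proof (intro conjI ballI)
    fix a assume a: "a \<in> Obj C"
    then show "is_iso C (FObj id_funct a) (FObj (comp_funct G F) a) (\<eta> a)"
      using groupoid_iso[OF C a gF(1)[OF a] \<eta>(1)[OF a]]
      by (simp add: id_funct_def comp_funct_def G_def)
  next
    fix a b f assume *: "a \<in> Obj C" "b \<in> Obj C" "f \<in> Hom C a b"
    let ?a = "g (FObj F a)" and ?b = "g (FObj F b)"
    have Ff: "FMap F a b f \<in> Hom D (FObj F a) (FObj F b)"
      using functor_Hom[OF F] * by blast
    have "Comp C a b ?b (\<eta> b) f = Comp C a ?a ?b (lift ?a ?b (FMap F a b f)) (\<eta> a)"
    proof (rule faithful[of a ?b])
      show "FMap F a ?b (Comp C a b ?b (\<eta> b) f)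
          = FMap F a ?b (Comp C a ?a ?b (lift ?a ?b (FMap F a b f)) (\<eta> a))"
        using * Ff
        by (simp add: functor_Comp[OF F, where b = b] functor_Comp[OF F, where b = ?a] gF \<eta>
            F_lift lift_Hom functor_Obj[OF F] category_Id_left[OF DD] category_Id_right[OF DD])
    qed (use * Ff in \<open>auto intro!: category_Comp[OF CC, where b = b]
          category_Comp[OF CC, where b = ?a] lift_Hom simp: gF \<eta>\<close>)
    then show "Comp C (FObj id_funct a) (FObj id_funct b) (FObj (comp_funct G F) b) (\<eta> b)
        (FMap id_funct a b f) = Comp C (FObj id_funct a) (FObj (comp_funct G F) a)
        (FObj (comp_funct G F) b) (FMap (comp_funct G F) a b f) (\<eta> a)"
      by (simp add: id_funct_def comp_funct_def G_def)
  qed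
  \<comment> \<open>Here \<open>F\<close> after \<open>G\<close> is the identity on objects and on
    morphisms, so identities form the counit.\<close>
  have "is_nat_iso D D (comp_funct F G) id_funct (Id D)"
    unfolding is_nat_iso_def
    by (auto simp: id_funct_def comp_funct_def G_def g F_lift
        category_Id_left[OF DD] category_Id_right[OF DD]
        intro!: groupoid_iso[OF D] category_Id[OF DD])
  with C D CC DD F G \<eta>_iso show ?thesis
    unfolding equivalent_groupoids_def equivalent_categories_def by blast
qed

text \<open>Shared by \<open>Perm\<close> and \<open>cycle_groupoid\<close>, whose morphisms are
  bijections of underlying sets \<open>S a\<close>. Extensionality turns pointwise agreement on
  \<open>S a\<close> into equality, so the category laws come from those of functions and only
  closure of the hom-sets remains to be shown.\<close>

lemma concrete_groupoid:
  assumes hom: "\<And>a b f. a \<in> Obj C \<Longrightarrow> b \<in> Obj C \<Longrightarrow> f \<in> Hom C a b \<Longrightarrow>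
      f \<in> extensional (S a) \<and> bij_betw f (S a) (S b)"
    and Id: "\<And>a. a \<in> Obj C \<Longrightarrow> Id C a = (\<lambda>x\<in>S a. x)"
    and Comp: "\<And>a b c g f. a \<in> Obj C \<Longrightarrow> Comp C a b c g f = compose (S a) g f"
    and Id_hom: "\<And>a. a \<in> Obj C \<Longrightarrow> (\<lambda>x\<in>S a. x) \<in> Hom C a a"
    and Comp_hom: "\<And>a b c f g. a \<in> Obj C \<Longrightarrow> b \<in> Obj C \<Longrightarrow> c \<in> Obj C \<Longrightarrow>
      f \<in> Hom C a b \<Longrightarrow> g \<in> Hom C b c \<Longrightarrow> compose (S a) g f \<in> Hom C a c"
    and inv_hom: "\<And>a b f. a \<in> Obj C \<Longrightarrow> b \<in> Obj C \<Longrightarrow> f \<in> Hom C a b \<Longrightarrow>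
      (\<lambda>y\<in>S b. inv_into (S a) f y) \<in> Hom C b a"
  shows "is_groupoid C"
proof -
  have fset: "f \<in> S a \<rightarrow> S b" if "a \<in> Obj C" "b \<in> Obj C" "f \<in> Hom C a b" for a b f
    using hom[OF that] bij_betw_apply by fastforce
  have Id_compose_hom: "compose (S a) f (\<lambda>x\<in>S a. x) = f" "compose (S a) (\<lambda>x\<in>S b. x) f = f"
    if "a \<in> Obj C" "b \<in> Obj C" "f \<in> Hom C a b" for a b f
    using compose_Id[OF fset[OF that]] Id_compose[OF fset[OF that]] hom[OF that] by auto
  have "is_category C"
    unfolding is_category_def
    using fset by (auto simp: Id Comp Id_hom Comp_hom Id_compose_hom compose_assoc)
  moreover have "is_iso C a b f" if "a \<in> Obj C" "b \<in> Obj C" "f \<in> Hom C a b" for a b f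
    using hom[OF that] that inv_hom[OF that] unfolding is_iso_def
    by (intro conjI bexI[of _ "\<lambda>y\<in>S b. inv_into (S a) f y"])
      (simp_all add: Id Comp compose_inv_into_id compose_id_inv_into bij_betw_imp_surj_on)
  ultimately show ?thesis by (simp add: is_groupoid_def)
qed

section \<open>Deloopings and products of groupoids\<close>

lemma groupoid_delooping:
  assumes "group G"
  shows "is_groupoid (delooping G)"
proof -
  interpret group G by fact
  show ?thesis
    unfolding is_groupoid_def is_category_def is_iso_def delooping_def
    by (auto simp: m_assoc intro: bexI[of _ "inv\<^bsub>G\<^esub> _"] l_inv r_inv)
qed

lemma groupoid_prod_cat:
  assumes "is_groupoid C" "is_groupoid D"
  shows "is_groupoid (prod_cat C D)"
proof -
  have "is_category (prod_cat C D)"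
    using assms[THEN groupoid_category]
    unfolding is_category_def prod_cat_def by (simp add: mem_Times_iff)
  moreover have "is_iso (prod_cat C D) a b f"
    if f: "a \<in> Obj (prod_cat C D)" "b \<in> Obj (prod_cat C D)" "f \<in> Hom (prod_cat C D) a b" for a b f
  proof -
    have "is_iso C (fst a) (fst b) (fst f)" "is_iso D (snd a) (snd b) (snd f)"
      using f assms by (auto simp: prod_cat_def intro!: groupoid_iso)
    then show ?thesis
      unfolding is_iso_def prod_cat_def by (auto simp: mem_Times_iff intro!: bexI[of _ "(_, _)"])
  qed
  ultimately show ?thesis by (simp add: is_groupoid_def)
qed

lemma groupoid_Prod_cat:
  assumes "\<And>i. i \<in> I \<Longrightarrow> is_groupoid (C i)"
  shows "is_groupoid (Prod_cat I C)"
proof -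
  have cat: "is_category (C i)" if "i \<in> I" for i
    using assms[OF that] by (rule groupoid_category)
  have "is_category (Prod_cat I C)"
    unfolding is_category_def Prod_cat_def
    by (auto simp: PiE_iff category_Id[OF cat] fun_eq_iff extensional_def
        category_Id_left[OF cat] category_Id_right[OF cat] category_assoc[OF cat]
        intro!: category_Comp[OF cat])
  moreover have "is_iso (Prod_cat I C) a b f"
    if f: "a \<in> Obj (Prod_cat I C)" "b \<in> Obj (Prod_cat I C)" "f \<in> Hom (Prod_cat I C) a b" for a b f
  proof -
    have "\<forall>i\<in>I. is_iso (C i) (a i) (b i) (f i)"
      using f assms by (auto simp: Prod_cat_def intro!: groupoid_iso)
    then obtain g where g: "\<And>i. i \<in> I \<Longrightarrow> g i \<in> Hom (C i) (b i) (a i) \<and>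
        Comp (C i) (a i) (b i) (a i) (g i) (f i) = Id (C i) (a i) \<and>
        Comp (C i) (b i) (a i) (b i) (f i) (g i) = Id (C i) (b i)"
      unfolding is_iso_def by metis
    have "restrict g I \<in> Hom (Prod_cat I C) b a"
      using g by (simp add: Prod_cat_def)
    with f g show ?thesis
      unfolding is_iso_def
      by (intro conjI bexI[of _ "restrict g I"]) (auto simp: Prod_cat_def intro!: restrict_ext)
  qed
  ultimately show ?thesis by (simp add: is_groupoid_def)
qed


section \<open>Permutation-preserving bijections\<close>

text \<open>Substituting \<open>y = f x\<close> turns the conjugation equation of the definition
  into commutation with the permutations, the form used from here on.\<close>

lemma perm_preserving_iff:
  "f \<in> perm_preserving X \<sigma> X' \<sigma>' \<longleftrightarrow>
    f \<in> extensional X \<and> bij_betw f X X' \<and> (\<forall>x\<in>X. f (\<sigma> x) = \<sigma>' (f x))"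
proof -
  have "(\<forall>y\<in>X'. f (\<sigma> (inv_into X f y)) = \<sigma>' y) \<longleftrightarrow> (\<forall>x\<in>X. f (\<sigma> x) = \<sigma>' (f x))"
    if "bij_betw f X X'"
    unfolding bij_betw_imp_surj_on[OF that, symmetric]
    by (simp add: bij_betw_inv_into_left[OF that])
  then show ?thesis unfolding perm_preserving_def by blast
qed

lemma perm_preserving_id: "\<sigma> permutes X \<Longrightarrow> (\<lambda>x\<in>X. x) \<in> perm_preserving X \<sigma> X \<sigma>"
  by (auto simp: perm_preserving_iff permutes_in_image bij_betw_def inj_on_def)

lemma perm_preserving_compose:
  assumes f: "f \<in> perm_preserving X \<sigma> X' \<sigma>'" and g: "g \<in> perm_preserving X' \<sigma>' X'' \<sigma>''"
    and "\<sigma> permutes X"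
  shows "compose X g f \<in> perm_preserving X \<sigma> X'' \<sigma>''"
proof -
  have bij: "bij_betw f X X'" "bij_betw g X' X''"
    using f g by (auto simp: perm_preserving_iff)
  have "g (f (\<sigma> x)) = \<sigma>'' (g (f x))" if "x \<in> X" for x
    using f g that bij_betw_apply[OF bij(1) that] by (simp add: perm_preserving_iff)
  then show ?thesis
    using bij_betw_compose[OF bij] assms(3)
    by (simp add: perm_preserving_iff compose_eq permutes_in_image)
qed

lemma perm_preserving_inv:
  assumes "f \<in> perm_preserving X \<sigma> X' \<sigma>'" "\<sigma> permutes X" "\<sigma>' permutes X'"
  shows "(\<lambda>y\<in>X'. inv_into X f y) \<in> perm_preserving X' \<sigma>' X \<sigma>"
proof -
  have f: "bij_betw f X X'" "\<And>x. x \<in> X \<Longrightarrow> f (\<sigma> x) = \<sigma>' (f x)"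
    using assms by (auto simp: perm_preserving_iff)
  have "inv_into X f (\<sigma>' y) = \<sigma> (inv_into X f y)" if y: "y \<in> X'" for y
  proof -
    obtain x where x: "x \<in> X" "y = f x"
      using y bij_betw_imp_surj_on[OF f(1)] by blast
    then show ?thesis
      using f assms(2) by (metis bij_betw_inv_into_left permutes_in_image)
  qed
  moreover have "bij_betw (\<lambda>y\<in>X'. inv_into X f y) X' X"
    using bij_betw_inv_into[OF f(1)] by (simp cong: bij_betw_cong)
  ultimately show ?thesis
    using assms(3) by (simp add: perm_preserving_iff permutes_in_image)
qed

text \<open>The source of rigidity on cycles: the image of one point determines the images of all
  its iterates.\<close>

lemma perm_preserving_funpow:
  assumes "f \<in> perm_preserving X \<sigma> X' \<sigma>'" "\<sigma> permutes X" "x \<in> X"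
  shows "f ((\<sigma> ^^ j) x) = (\<sigma>' ^^ j) (f x)"
proof (induction j)
  case (Suc j)
  have "f (\<sigma> ((\<sigma> ^^ j) x)) = \<sigma>' (f ((\<sigma> ^^ j) x))"
    using assms(1) permutes_in_funpow_image[OF assms(2,3)] unfolding perm_preserving_iff by blast
  with Suc show ?case by simp
qed simp

lemma perm_preserving_orbit:
  assumes "f \<in> perm_preserving X \<sigma> X' \<sigma>'" "\<sigma> permutes X" "x \<in> X"
  shows "f ` orbit \<sigma> x = orbit \<sigma>' (f x)"
  by (simp add: orbit_altdef setcompr_eq_image image_image perm_preserving_funpow[OF assms])

lemma groupoid_Perm: "is_groupoid (Perm m)"
  by (rule concrete_groupoid[where S = fst])
    (auto simp: Perm_def perm_preserving_id perm_preserving_inv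
      intro: perm_preserving_compose dest: perm_preserving_iff[THEN iffD1])


section \<open>Permutations with chosen cycles\<close>

definition chosen_points :: "nat \<Rightarrow> (nat \<Rightarrow> 'a set list) \<Rightarrow> 'a set" where
  "chosen_points n c = (\<Union>k\<in>{1..n}. \<Union>(set (c k)))"

text \<open>
  The choice of a base point identifies the \<open>i\<close>-th chosen \<open>k\<close>-cycle with \<open>\<int>/k\<close>; the tuples are
  indexed from \<open>1\<close> in the product of deloopings, but lists from \<open>0\<close>.
\<close>

definition cycle_point :: "('a \<Rightarrow> 'a) \<Rightarrow> (nat \<Rightarrow> 'a set list) \<Rightarrow> nat \<Rightarrow> nat \<Rightarrow> nat \<Rightarrow> 'a" where
  "cycle_point \<sigma> c k i j = (\<sigma> ^^ j) (SOME x. x \<in> c k ! (i - 1))"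

text \<open>Triples of cycle length, position in the tuple and residue. The set depends on
  \<open>n\<close> and \<open>p\<close> only, so it gives the chosen points of every object the same
  coordinates.\<close>

definition cycle_index :: "nat \<Rightarrow> (nat \<Rightarrow> nat) \<Rightarrow> (nat \<times> nat \<times> nat) set" where
  "cycle_index n p = (SIGMA k:{1..n}. {1..p k} \<times> {..<k})"

lemma finite_cycle_index: "finite (cycle_index n p)"
  by (simp add: cycle_index_def)

lemma card_cycle_index: "card (cycle_index n p) = weight n p"
  by (simp add: cycle_index_def weight_def card_cartesian_product mult.commute)

lemma cycle_index_iff:
  "(k, i, j) \<in> cycle_index n p \<longleftrightarrow> k \<in> {1..n} \<and> i \<in> {1..p k} \<and> j < k"
  by (simp add: cycle_index_def)

locale marked_permutation =
  fixes n :: nat and p :: "nat \<Rightarrow> nat"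
    and X :: "'a set" and \<sigma> :: "'a \<Rightarrow> 'a" and c :: "nat \<Rightarrow> 'a set list"
  assumes obj: "(X, \<sigma>, c) \<in> Obj (cycle_groupoid n p)"
begin

lemma finite: "finite X" and card: "card X = n" and permutes: "\<sigma> permutes X"
  using obj by (auto simp: cycle_groupoid_def)

lemma length_chosen: "k \<in> {1..n} \<Longrightarrow> length (c k) = p k"
  and distinct_chosen: "k \<in> {1..n} \<Longrightarrow> distinct (c k)"
  and chosen_cycles: "k \<in> {1..n} \<Longrightarrow> set (c k) \<subseteq> cycles_of_length X \<sigma> k"
  using obj by (auto simp: cycle_groupoid_def PiE_iff)

lemma permutation: "permutation \<sigma>"
  using finite permutes by (auto simp: permutation_permutes)

lemma nth_mem_chosen:
  assumes "k \<in> {1..n}" "i \<in> {1..p k}"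
  shows "c k ! (i - 1) \<in> set (c k)"
  using assms(2) by (intro nth_mem) (auto simp: length_chosen[OF assms(1)])

lemma nth_chosen:
  assumes "k \<in> {1..n}" "i \<in> {1..p k}"
  shows "c k ! (i - 1) \<in> cycles_of_length X \<sigma> k"
  using nth_mem_chosen[OF assms] chosen_cycles[OF assms(1)] by blast

lemma chosen_nth:
  assumes "k \<in> {1..n}" "C \<in> set (c k)"
  obtains i where "i \<in> {1..p k}" "C = c k ! (i - 1)"
proof -
  obtain m where "m < p k" "C = c k ! m"
    using assms by (auto simp: in_set_conv_nth length_chosen)
  then show thesis by (intro that[of "Suc m"]) auto
qed

text \<open>A chosen cycle is cyclic under \<sigma>, hence the orbit of each of its points. The free
  \<open>j\<close> allows the cycle to be recovered from any point, not only from the base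
  point.\<close>

lemma nth_chosen_eq_orbit:
  assumes "k \<in> {1..n}" "i \<in> {1..p k}"
  shows "c k ! (i - 1) = orbit \<sigma> (cycle_point \<sigma> c k i j)"
proof -
  obtain x where x: "x \<in> X" "c k ! (i - 1) = orbit \<sigma> x"
    using nth_chosen[OF assms] by (auto simp: cycles_of_length_def)
  have cyc: "cyclic_on \<sigma> (c k ! (i - 1))"
    unfolding x by (rule cyclic_on_orbit'[OF permutation])
  \<comment> \<open>A cyclic set is nonempty, so the choice really yields one of its points.\<close>
  then have "(SOME x. x \<in> c k ! (i - 1)) \<in> c k ! (i - 1)"
    by (simp add: cyclic_on_alldef some_in_eq)
  with cyc have "cycle_point \<sigma> c k i j \<in> c k ! (i - 1)"
    unfolding cycle_point_def by (rule cyclic_on_funpow_in)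
  with cyc show ?thesis by (simp add: orbit_cyclic_eq3)
qed

section \<open>Coordinates on the chosen points\<close>

lemma cycle_point_step: "\<sigma> (cycle_point \<sigma> c k i j) = cycle_point \<sigma> c k i (Suc j)"
  by (simp add: cycle_point_def)

lemma cycle_point_add: "(\<sigma> ^^ m) (cycle_point \<sigma> c k i j) = cycle_point \<sigma> c k i (m + j)"
  by (simp add: cycle_point_def funpow_add)

text \<open>\<open>funpow_dist1\<close> gives the first return time of the base point. The iterates
  before it enumerate the orbit without repetition, so it equals the size \<open>k\<close> of the
  orbit; periodicity then allows any exponent to be reduced modulo \<open>k\<close>.\<close>

lemma
  assumes "k \<in> {1..n}" "i \<in> {1..p k}"
  shows nth_chosen_eq_image: "c k ! (i - 1) = cycle_point \<sigma> c k i ` {..<k}"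
    and inj_on_cycle_point: "inj_on (cycle_point \<sigma> c k i) {..<k}"
    and cycle_point_mod: "cycle_point \<sigma> c k i (j mod k) = cycle_point \<sigma> c k i j"
proof -
  define x where "x = cycle_point \<sigma> c k i 0"
  have pt: "cycle_point \<sigma> c k i = (\<lambda>j. (\<sigma> ^^ j) x)"
    by (simp add: cycle_point_add x_def)
  have orb: "c k ! (i - 1) = orbit \<sigma> x"
    unfolding x_def by (rule nth_chosen_eq_orbit[OF assms])
  have x: "x \<in> orbit \<sigma> x"
    by (rule permutation_self_in_orbit[OF permutation])
  have image: "orbit \<sigma> x = (\<lambda>j. (\<sigma> ^^ j) x) ` {0..<funpow_dist1 \<sigma> x x}"
    by (rule orbit_conv_funpow_dist1[OF x])
  have inj: "inj_on (\<lambda>j. (\<sigma> ^^ j) x) {0..<funpow_dist1 \<sigma> x x}"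
    by (rule inj_on_funpow_dist1[OF x])
  have "card (orbit \<sigma> x) = k"
    using nth_chosen[OF assms] unfolding orb by (auto simp: cycles_of_length_def)
  then have k: "funpow_dist1 \<sigma> x x = k"
    using card_image[OF inj] image by simp
  show "c k ! (i - 1) = cycle_point \<sigma> c k i ` {..<k}" "inj_on (cycle_point \<sigma> c k i) {..<k}"
    using image inj by (simp_all only: orb pt k lessThan_atLeast0)
  show "cycle_point \<sigma> c k i (j mod k) = cycle_point \<sigma> c k i j"
    unfolding pt by (rule funpow_mod_eq) (use funpow_dist1_prop[OF x] in \<open>simp only: k\<close>)
qed

text \<open>For injectivity, a point determines its orbit, the size of the orbit determines
  \<open>k\<close>, distinctness of the tuple determines \<open>i\<close>, and injectivity along a
  cycle determines \<open>j\<close>.\<close>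

lemma bij_betw_cycle_point:
  "bij_betw (\<lambda>(k, i, j). cycle_point \<sigma> c k i j) (cycle_index n p) (chosen_points n c)"
proof (rule bij_betw_imageI)
  show "inj_on (\<lambda>(k, i, j). cycle_point \<sigma> c k i j) (cycle_index n p)"
  proof (rule inj_onI)
    fix u v
    assume uv: "u \<in> cycle_index n p" "v \<in> cycle_index n p"
      "(case u of (k, i, j) \<Rightarrow> cycle_point \<sigma> c k i j)
        = (case v of (k, i, j) \<Rightarrow> cycle_point \<sigma> c k i j)"
    obtain k i j k' i' j' where uv_def: "u = (k, i, j)" "v = (k', i', j')"
      by (metis prod_cases3)
    with uv have eq: "cycle_point \<sigma> c k i j = cycle_point \<sigma> c k' i' j'"
      by simp
    from uv uv_def have k: "k \<in> {1..n}" "i \<in> {1..p k}" "j < k"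
      and k': "k' \<in> {1..n}" "i' \<in> {1..p k'}" "j' < k'"
      by (auto simp: cycle_index_iff)
    have orb: "c k ! (i - 1) = c k' ! (i' - 1)"
      using nth_chosen_eq_orbit[OF k(1,2), of j] nth_chosen_eq_orbit[OF k'(1,2), of j'] eq by simp
    then have kk: "k = k'"
      using nth_chosen[OF k(1,2)] nth_chosen[OF k'(1,2)] by (auto simp: cycles_of_length_def)
    have "i - 1 < length (c k)" "i' - 1 < length (c k)"
      using k k' length_chosen[OF k(1)] kk by auto
    then have "i - 1 = i' - 1"
      using orb kk nth_eq_iff_index_eq[OF distinct_chosen[OF k(1)]] by blast
    \<comment> \<open>Both indices are at least 1, so the truncated subtraction can be
      cancelled.\<close>
    then have ii: "i = i'"
      using k(2) k'(2) unfolding atLeastAtMost_iff by linarith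
    have "j = j'"
      using eq k k' inj_onD[OF inj_on_cycle_point[OF k(1,2)], of j j'] kk ii by simp
    with kk ii show "u = v" by (simp add: uv_def)
  qed
  show "(\<lambda>(k, i, j). cycle_point \<sigma> c k i j) ` cycle_index n p = chosen_points n c" (is "?L = ?R")
  proof
    show "?L \<subseteq> ?R"
    proof clarify
      fix k i j assume "(k, i, j) \<in> cycle_index n p"
      then have k: "k \<in> {1..n}" "i \<in> {1..p k}" "j < k"
        by (auto simp: cycle_index_iff)
      then have "cycle_point \<sigma> c k i j \<in> c k ! (i - 1)" "c k ! (i - 1) \<in> set (c k)"
        using nth_chosen_eq_image[OF k(1,2)] nth_mem_chosen[OF k(1,2)] by auto
      with k show "cycle_point \<sigma> c k i j \<in> chosen_points n c"
        unfolding chosen_points_def by blast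
    qed
    show "?R \<subseteq> ?L"
    proof
      fix x assume "x \<in> chosen_points n c"
      then obtain k C where k: "k \<in> {1..n}" "C \<in> set (c k)" "x \<in> C"
        unfolding chosen_points_def by blast
      then obtain i where i: "i \<in> {1..p k}" "C = c k ! (i - 1)"
        using chosen_nth by blast
      with k nth_chosen_eq_image[OF k(1) i(1)] obtain j where "j < k" "x = cycle_point \<sigma> c k i j"
        by auto
      with k i show "x \<in> ?L"
        by (intro image_eqI[of _ _ "(k, i, j)"]) (auto simp: cycle_index_iff)
    qed
  qed
qed

lemma chosen_pointsE:
  assumes "x \<in> chosen_points n c"
  obtains k i j where "k \<in> {1..n}" "i \<in> {1..p k}" "j < k" "x = cycle_point \<sigma> c k i j"
  using assms bij_betw_imp_surj_on[OF bij_betw_cycle_point, symmetric]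
  by (auto simp: cycle_index_iff)

lemma cycle_point_chosen:
  assumes "k \<in> {1..n}" "i \<in> {1..p k}"
  shows "cycle_point \<sigma> c k i j \<in> chosen_points n c"
proof -
  have "(k, i, j mod k) \<in> cycle_index n p"
    using assms by (simp add: cycle_index_iff)
  from bij_betw_apply[OF bij_betw_cycle_point this] show ?thesis
    using cycle_point_mod[OF assms] by simp
qed

lemma chosen_points_subset: "chosen_points n c \<subseteq> X"
  using chosen_cycles permutes_orbit_subset[OF permutes]
  by (fastforce simp: chosen_points_def cycles_of_length_def)

lemma cycle_point_in: "k \<in> {1..n} \<Longrightarrow> i \<in> {1..p k} \<Longrightarrow> cycle_point \<sigma> c k i j \<in> X"
  using cycle_point_chosen chosen_points_subset by blast

text \<open>The chosen points lie in \<open>X\<close>, so the existence of an object forces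
  \<open>weight n p\<close> to be at most \<open>n\<close>; the integer difference is therefore a
  genuine cardinality.\<close>

lemma card_rest: "int (card (X - chosen_points n c)) = int n - int (weight n p)"
proof -
  have "card (chosen_points n c) = weight n p"
    using bij_betw_same_card[OF bij_betw_cycle_point] by (simp add: card_cycle_index)
  then show ?thesis
    using card_mono[OF finite chosen_points_subset] card_Diff_subset[OF _ chosen_points_subset]
      finite_subset[OF chosen_points_subset finite] card by simp
qed

section \<open>The permutation of the remaining points\<close>

lemma image_chosen_points: "\<sigma> ` chosen_points n c = chosen_points n c"
proof (rule endo_inj_surj)
  show "finite (chosen_points n c)"
    by (rule finite_subset[OF chosen_points_subset finite])
  show "\<sigma> ` chosen_points n c \<subseteq> chosen_points n c"
    by (auto elim!: chosen_pointsE simp: cycle_point_step cycle_point_chosen)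
  show "inj_on \<sigma> (chosen_points n c)"
    by (rule permutes_inj_on[OF permutes])
qed

lemma rest_closed: "\<sigma> x \<in> X - chosen_points n c \<longleftrightarrow> x \<in> X - chosen_points n c"
proof -
  have "\<sigma> x \<in> chosen_points n c \<longleftrightarrow> x \<in> chosen_points n c"
    using inj_image_mem_iff[OF permutes_inj[OF permutes], of x "chosen_points n c"]
    by (simp add: image_chosen_points)
  then show ?thesis
    by (simp add: permutes_in_image[OF permutes])
qed

text \<open>\<sigma> itself still moves the chosen points, whereas objects of \<open>Perm\<close>
  must be the identity off their set; hence \<open>perm_restrict\<close>.\<close>

lemma perm_restrict_permutes:
  "perm_restrict \<sigma> (X - chosen_points n c) permutes (X - chosen_points n c)"
proof (rule bij_imp_permutes)
  have "\<sigma> ` (X - chosen_points n c) = X - chosen_points n c"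
    by (simp add: image_set_diff permutes_inj[OF permutes] permutes_image[OF permutes]
        image_chosen_points)
  then have "bij_betw \<sigma> (X - chosen_points n c) (X - chosen_points n c)"
    by (simp add: bij_betw_def permutes_inj_on[OF permutes])
  then show "bij_betw (perm_restrict \<sigma> (X - chosen_points n c))
      (X - chosen_points n c) (X - chosen_points n c)"
    by (subst bij_betw_cong[where g = \<sigma>]) (simp_all add: perm_restrict_simps)
qed (rule perm_restrict_simps)

lemma chosen_subset:
  "k \<in> {1..n} \<Longrightarrow> C \<in> set (c k) \<Longrightarrow> C \<subseteq> X"
  using chosen_points_subset unfolding chosen_points_def by blast

end


section \<open>Morphisms as shifts of the chosen cycles\<close>

lemma marked_permutationI: "(X, \<sigma>, c) \<in> Obj (cycle_groupoid n p) \<Longrightarrow> marked_permutation n p X \<sigma> c"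
  by (simp add: marked_permutation_def)

lemma Hom_cycle_groupoid:
  "f \<in> Hom (cycle_groupoid n p) (X, \<sigma>, c) (X', \<sigma>', c') \<longleftrightarrow>
    f \<in> perm_preserving X \<sigma> X' \<sigma>' \<and> (\<forall>k\<in>{1..n}. map ((`) f) (c k) = c' k)"
  by (simp add: cycle_groupoid_def)

text \<open>What goes beyond permutation-preserving bijections is the effect on the tuples. The
  chosen cycles are subsets of \<open>X\<close>, so the restrictions built into identities,
  composites and inverses do not affect their images.\<close>

lemma groupoid_cycle_groupoid: "is_groupoid (cycle_groupoid n p)"
proof (rule concrete_groupoid[where S = fst], goal_cases)
  case (1 a b f)
  then show ?case
    by (cases a, cases b) (auto simp: Hom_cycle_groupoid perm_preserving_iff)
next
  case (2 a)
  then show ?case by (auto simp: cycle_groupoid_def)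
next
  case (3 a b c g f)
  then show ?case by (auto simp: cycle_groupoid_def)
next
  case (4 a)
  obtain X \<sigma> c where a: "a = (X, \<sigma>, c)" by (cases a)
  interpret marked_permutation n p X \<sigma> c
    using 4 a by (simp add: marked_permutationI)
  have "map ((`) (\<lambda>x\<in>X. x)) (c k) = c k" if "k \<in> {1..n}" for k
  proof (rule map_idI)
    fix C assume "C \<in> set (c k)"
    then show "(\<lambda>x\<in>X. x) ` C = C"
      using chosen_subset[OF that] by force
  qed
  then show ?case
    using perm_preserving_id[OF permutes] by (simp add: a Hom_cycle_groupoid)
next
  case (5 a1 a2 a3 f g)
  obtain X \<sigma> c X' \<sigma>' c' X'' \<sigma>'' c''
    where a: "a1 = (X, \<sigma>, c)" "a2 = (X', \<sigma>', c')" "a3 = (X'', \<sigma>'', c'')"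
    by (metis prod_cases3)
  interpret marked_permutation n p X \<sigma> c
    using 5 a by (simp add: marked_permutationI)
  have fg: "f \<in> perm_preserving X \<sigma> X' \<sigma>'" "\<forall>k\<in>{1..n}. map ((`) f) (c k) = c' k"
    "g \<in> perm_preserving X' \<sigma>' X'' \<sigma>''" "\<forall>k\<in>{1..n}. map ((`) g) (c' k) = c'' k"
    using 5 by (auto simp: a Hom_cycle_groupoid)
  have "map ((`) (compose X g f)) (c k) = c'' k" if k: "k \<in> {1..n}" for k
  proof -
    have "compose X g f ` C = g ` f ` C" if "C \<in> set (c k)" for C
      unfolding image_image using chosen_subset[OF k that]
      by (intro image_cong) (auto simp: compose_eq)
    then have "map ((`) (compose X g f)) (c k) = map ((`) g) (map ((`) f) (c k))"
      by simp
    then show ?thesis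
      by (simp only: bspec[OF fg(2) k] bspec[OF fg(4) k])
  qed
  then show ?case
    using perm_preserving_compose[OF fg(1,3) permutes] by (simp add: a Hom_cycle_groupoid)
next
  case (6 a b f)
  obtain X \<sigma> c X' \<sigma>' c' where a: "a = (X, \<sigma>, c)" "b = (X', \<sigma>', c')"
    by (metis prod_cases3)
  interpret marked_permutation n p X \<sigma> c
    using 6 a by (simp add: marked_permutationI)
  interpret tgt: marked_permutation n p X' \<sigma>' c'
    using 6 a by (simp add: marked_permutationI)
  have f: "f \<in> perm_preserving X \<sigma> X' \<sigma>'" "\<forall>k\<in>{1..n}. map ((`) f) (c k) = c' k"
    using 6 by (auto simp: a Hom_cycle_groupoid)
  then have bij: "bij_betw f X X'"
    by (simp add: perm_preserving_iff)
  have "map ((`) (\<lambda>y\<in>X'. inv_into X f y)) (c' k) = c k" if k: "k \<in> {1..n}" for k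
  proof -
    have "(\<lambda>y\<in>X'. inv_into X f y) ` f ` C = C" if "C \<in> set (c k)" for C
    proof -
      have "(\<lambda>y\<in>X'. inv_into X f y) (f x) = x" if "x \<in> C" for x
        using that chosen_subset[OF k \<open>C \<in> set (c k)\<close>] bij
        by (auto simp: bij_betw_inv_into_left bij_betw_apply)
      then have "(\<lambda>x. (\<lambda>y\<in>X'. inv_into X f y) (f x)) ` C = (\<lambda>x. x) ` C"
        by (intro image_cong refl)
      then show ?thesis by (simp only: image_image image_ident)
    qed
    then have "map ((`) (\<lambda>y\<in>X'. inv_into X f y)) (map ((`) f) (c k)) = c k"
      by (simp add: map_idI)
    then show ?thesis by (simp only: bspec[OF f(2) k])
  qed
  then show ?case
    using perm_preserving_inv[OF f(1) permutes tgt.permutes] by (simp add: a Hom_cycle_groupoid)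
qed

text \<open>The coordinate, taken in \<open>{..<k}\<close>, of the image of the source base point
  relative to the base point of the target cycle. For a morphism \<open>f\<close> this image does
  lie in the \<open>i\<close>-th chosen \<open>k\<close>-cycle of the target.\<close>

definition cycle_shift :: "('a \<Rightarrow> 'a) \<Rightarrow> (nat \<Rightarrow> 'a set list) \<Rightarrow> ('a \<Rightarrow> 'a) \<Rightarrow> (nat \<Rightarrow> 'a set list) \<Rightarrow>
    ('a \<Rightarrow> 'a) \<Rightarrow> nat \<Rightarrow> nat \<Rightarrow> nat" where
  "cycle_shift \<sigma> c \<sigma>' c' f k i =
    inv_into {..<k} (cycle_point \<sigma>' c' k i) (f (cycle_point \<sigma> c k i 0))"

locale marked_permutation_pair =
  src: marked_permutation n p X \<sigma> c + tgt: marked_permutation n p X' \<sigma>' c'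
  for n p and X :: "'a set" and \<sigma> c and X' :: "'a set" and \<sigma>' c'
begin

abbreviation homs :: "('a \<Rightarrow> 'a) set" where
  "homs \<equiv> Hom (cycle_groupoid n p) (X, \<sigma>, c) (X', \<sigma>', c')"

text \<open>A permutation-preserving map carries orbits onto orbits, so a chosen cycle goes to the
  correct cycle as soon as its base point does.\<close>

lemma homs_iff:
  "f \<in> homs \<longleftrightarrow> f \<in> perm_preserving X \<sigma> X' \<sigma>' \<and>
    (\<forall>k\<in>{1..n}. \<forall>i\<in>{1..p k}. \<exists>m<k. f (cycle_point \<sigma> c k i 0) = cycle_point \<sigma>' c' k i m)"
proof -
  have "map ((`) f) (c k) = c' k \<longleftrightarrow>
      (\<forall>i\<in>{1..p k}. \<exists>m<k. f (cycle_point \<sigma> c k i 0) = cycle_point \<sigma>' c' k i m)"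
    if k: "k \<in> {1..n}" and f: "f \<in> perm_preserving X \<sigma> X' \<sigma>'" for k
  proof -
    have "map ((`) f) (c k) = c' k \<longleftrightarrow> (\<forall>i\<in>{1..p k}. f ` (c k ! (i - 1)) = c' k ! (i - 1))"
    proof (intro iffI ballI)
      fix i assume "map ((`) f) (c k) = c' k" "i \<in> {1..p k}"
      moreover from this have "i - 1 < length (c k)"
        using src.length_chosen[OF k] by auto
      ultimately show "f ` (c k ! (i - 1)) = c' k ! (i - 1)"
        by (metis nth_map)
    next
      assume *: "\<forall>i\<in>{1..p k}. f ` (c k ! (i - 1)) = c' k ! (i - 1)"
      show "map ((`) f) (c k) = c' k"
      proof (rule nth_equalityI)
        fix m assume "m < length (map ((`) f) (c k))"
        \<comment> \<open>Position \<open>m\<close> of the list is entry \<open>Suc m\<close> of the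
          tuple.\<close>
        then show "map ((`) f) (c k) ! m = c' k ! m"
          using src.length_chosen[OF k] bspec[OF *, of "Suc m"] by simp
      qed (simp add: src.length_chosen[OF k] tgt.length_chosen[OF k])
    qed
    also have "\<dots> \<longleftrightarrow> (\<forall>i\<in>{1..p k}. \<exists>m<k. f (cycle_point \<sigma> c k i 0) = cycle_point \<sigma>' c' k i m)"
    proof (rule ball_cong[OF refl])
      fix i assume i: "i \<in> {1..p k}"
      let ?x = "cycle_point \<sigma> c k i 0"
      have src: "f ` (c k ! (i - 1)) = orbit \<sigma>' (f ?x)"
        unfolding src.nth_chosen_eq_orbit[OF k i, of 0]
        by (rule perm_preserving_orbit[OF f src.permutes src.cycle_point_in[OF k i]])
      show "f ` (c k ! (i - 1)) = c' k ! (i - 1) \<longleftrightarrow> (\<exists>m<k. f ?x = cycle_point \<sigma>' c' k i m)"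
      proof
        assume "f ` (c k ! (i - 1)) = c' k ! (i - 1)"
        then have "f ?x \<in> c' k ! (i - 1)"
          using src permutation_self_in_orbit[OF tgt.permutation, of "f ?x"] by simp
        then show "\<exists>m<k. f ?x = cycle_point \<sigma>' c' k i m"
          unfolding tgt.nth_chosen_eq_image[OF k i] by auto
      next
        assume "\<exists>m<k. f ?x = cycle_point \<sigma>' c' k i m"
        then show "f ` (c k ! (i - 1)) = c' k ! (i - 1)"
          using src tgt.nth_chosen_eq_orbit[OF k i] by auto
      qed
    qed
    finally show ?thesis .
  qed
  then show ?thesis unfolding Hom_cycle_groupoid by blast
qed

text \<open>Admitting any exponent \<open>m\<close>, reduced only in the conclusion, makes the shift
  of a composite come out as a sum modulo \<open>k\<close>.\<close>

lemma cycle_shift_eq: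
  assumes "k \<in> {1..n}" "i \<in> {1..p k}"
    and "f (cycle_point \<sigma> c k i 0) = cycle_point \<sigma>' c' k i m"
  shows "cycle_shift \<sigma> c \<sigma>' c' f k i = m mod k"
proof -
  have "cycle_shift \<sigma> c \<sigma>' c' f k i
      = inv_into {..<k} (cycle_point \<sigma>' c' k i) (cycle_point \<sigma>' c' k i (m mod k))"
    using assms by (simp add: cycle_shift_def tgt.cycle_point_mod)
  also have "\<dots> = m mod k"
    using assms by (intro inv_into_f_f tgt.inj_on_cycle_point) auto
  finally show ?thesis .
qed

text \<open>Commutation with iterates spreads the shift of the base point over the whole cycle: the
  morphism adds one constant to every coordinate.\<close>

lemma
  assumes "f \<in> homs" "k \<in> {1..n}" "i \<in> {1..p k}"
  shows cycle_shift_less: "cycle_shift \<sigma> c \<sigma>' c' f k i < k"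
    and hom_cycle_point: "f (cycle_point \<sigma> c k i j)
      = cycle_point \<sigma>' c' k i (j + cycle_shift \<sigma> c \<sigma>' c' f k i)"
proof -
  obtain m where m: "m < k" "f (cycle_point \<sigma> c k i 0) = cycle_point \<sigma>' c' k i m"
    using assms homs_iff by blast
  have f: "f \<in> perm_preserving X \<sigma> X' \<sigma>'"
    using assms(1) homs_iff by blast
  have s: "cycle_shift \<sigma> c \<sigma>' c' f k i = m"
    using cycle_shift_eq[where f = f, OF assms(2,3) m(2)] m(1) by simp
  show "cycle_shift \<sigma> c \<sigma>' c' f k i < k"
    using m s by simp
  show "f (cycle_point \<sigma> c k i j)
      = cycle_point \<sigma>' c' k i (j + cycle_shift \<sigma> c \<sigma>' c' f k i)"
    using perm_preserving_funpow[OF f src.permutes src.cycle_point_in[OF assms(2,3)], of j 0]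
    by (simp add: m s src.cycle_point_add tgt.cycle_point_add)
qed

section \<open>Decomposing a morphism into a restriction and shifts\<close>

lemma image_chosen_points:
  assumes "f \<in> homs"
  shows "f ` chosen_points n c = chosen_points n c'"
proof -
  have "f ` chosen_points n c = (\<Union>k\<in>{1..n}. \<Union>(set (map ((`) f) (c k))))"
    by (simp add: chosen_points_def image_UN image_Union)
  also have "\<dots> = chosen_points n c'"
    using assms unfolding chosen_points_def Hom_cycle_groupoid by (intro SUP_cong) auto
  finally show ?thesis .
qed

lemma restrict_hom:
  assumes "f \<in> homs"
  shows "restrict f (X - chosen_points n c) \<in>
    perm_preserving (X - chosen_points n c) (perm_restrict \<sigma> (X - chosen_points n c))
      (X' - chosen_points n c') (perm_restrict \<sigma>' (X' - chosen_points n c'))"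
proof -
  have f: "bij_betw f X X'" "\<And>x. x \<in> X \<Longrightarrow> f (\<sigma> x) = \<sigma>' (f x)"
    using assms by (auto simp: Hom_cycle_groupoid perm_preserving_iff)
  have "f ` (X - chosen_points n c) = X' - chosen_points n c'"
    using f(1) src.chosen_points_subset image_chosen_points[OF assms]
    by (simp add: bij_betw_def inj_on_image_set_diff[where C = X])
  then have "bij_betw f (X - chosen_points n c) (X' - chosen_points n c')"
    using f(1) by (simp add: bij_betw_def inj_on_diff)
  then show ?thesis
    unfolding perm_preserving_iff bij_betw_restrict_eq
    using f(2) src.rest_closed by (auto simp: perm_restrict_def dest: bij_betw_apply)
qed

text \<open>This will give faithfulness: on a chosen cycle \<open>hom_cycle_point\<close> expresses
  the values through the shift alone.\<close>

lemma hom_eqI: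
  assumes f: "f \<in> homs" and g: "g \<in> homs"
    and rest: "\<And>x. x \<in> X - chosen_points n c \<Longrightarrow> f x = g x"
    and shift: "\<And>k i. k \<in> {1..n} \<Longrightarrow> i \<in> {1..p k} \<Longrightarrow>
      cycle_shift \<sigma> c \<sigma>' c' f k i = cycle_shift \<sigma> c \<sigma>' c' g k i"
  shows "f = g"
proof (rule extensionalityI)
  show "f \<in> extensional X" "g \<in> extensional X"
    using f g by (auto simp: Hom_cycle_groupoid perm_preserving_iff)
  fix x assume "x \<in> X"
  show "f x = g x"
  proof (cases "x \<in> chosen_points n c")
    case True
    then show ?thesis
      by (elim src.chosen_pointsE) (simp add: hom_cycle_point[OF f] hom_cycle_point[OF g] shift)
  qed (use rest \<open>x \<in> X\<close> in auto)
qed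

text \<open>This will give fullness. The values on chosen points are forced to be \<open>j\<close>
  goes to \<open>j + s k i\<close> in coordinates; this commutes with the permutations because both
  act as successor, and it is glued to \<open>h\<close> along the invariant complement.\<close>

lemma hom_exists:
  assumes h: "h \<in> perm_preserving (X - chosen_points n c) (perm_restrict \<sigma> (X - chosen_points n c))
      (X' - chosen_points n c') (perm_restrict \<sigma>' (X' - chosen_points n c'))"
    and s: "\<And>k i. k \<in> {1..n} \<Longrightarrow> i \<in> {1..p k} \<Longrightarrow> s k i < k"
  obtains f where "f \<in> homs" "restrict f (X - chosen_points n c) = h"
    "\<And>k i. k \<in> {1..n} \<Longrightarrow> i \<in> {1..p k} \<Longrightarrow> cycle_shift \<sigma> c \<sigma>' c' f k i = s k i"
proof -
  let ?U = "chosen_points n c" and ?U' = "chosen_points n c'"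
  let ?pt = "\<lambda>(k, i, j). cycle_point \<sigma> c k i j"
  let ?pt' = "\<lambda>(k, i, j). cycle_point \<sigma>' c' k i (j + s k i)"
  define u where "u x = ?pt' (inv_into (cycle_index n p) ?pt x)" for x
  define f where "f = (\<lambda>x\<in>X. if x \<in> ?U then u x else h x)"
  have u_pt: "u (cycle_point \<sigma> c k i j) = cycle_point \<sigma>' c' k i (j + s k i)"
    if ki: "k \<in> {1..n}" "i \<in> {1..p k}" for k i j
  proof -
    have idx: "(k, i, j mod k) \<in> cycle_index n p"
      using ki by (simp add: cycle_index_iff)
    have "u (cycle_point \<sigma> c k i j) = u (?pt (k, i, j mod k))"
      using src.cycle_point_mod[OF ki] by simp
    also have "\<dots> = ?pt' (k, i, j mod k)"
      unfolding u_def bij_betw_inv_into_left[OF src.bij_betw_cycle_point idx] ..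
    also have "\<dots> = cycle_point \<sigma>' c' k i (((j mod k) + s k i) mod k)"
      using tgt.cycle_point_mod[OF ki] by simp
    also have "\<dots> = cycle_point \<sigma>' c' k i (j + s k i)"
      using tgt.cycle_point_mod[OF ki] by (simp add: mod_add_left_eq)
    finally show ?thesis .
  qed
  have u: "bij_betw u ?U ?U'"
  proof -
    have "?U' \<subseteq> u ` ?U"
    proof
      fix y assume "y \<in> ?U'"
      then obtain k i j where ki: "k \<in> {1..n}" "i \<in> {1..p k}" "y = cycle_point \<sigma>' c' k i j"
        by (elim tgt.chosen_pointsE)
      \<comment> \<open>The preimage has coordinate \<open>j - s k i\<close> modulo
        \<open>k\<close>, written with \<open>k\<close> added to stay within the natural numbers;
        \<open>s k i < k\<close> makes the inner subtraction exact.\<close>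
      have "y = cycle_point \<sigma>' c' k i ((j + (k - s k i)) + s k i)"
        using s[OF ki(1,2)] ki tgt.cycle_point_mod[OF ki(1,2), of "j + k"]
          tgt.cycle_point_mod[OF ki(1,2), of j] by simp
      then show "y \<in> u ` ?U"
        using u_pt[OF ki(1,2)] src.cycle_point_chosen[OF ki(1,2)] by (metis image_eqI)
    qed
    moreover have "u ` ?U \<subseteq> ?U'"
      by (auto elim!: src.chosen_pointsE simp: u_pt tgt.cycle_point_chosen)
    \<comment> \<open>Both sets have \<open>cycle_index n p\<close> as coordinates, so the
      surjection \<open>u\<close> between finite sets of equal size is a bijection.\<close>
    moreover have "card ?U = card ?U'" "finite ?U"
      using bij_betw_same_card[OF src.bij_betw_cycle_point]
        bij_betw_same_card[OF tgt.bij_betw_cycle_point]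
        finite_subset[OF src.chosen_points_subset src.finite] by auto
    ultimately show ?thesis
      by (simp add: bij_betw_def eq_card_imp_inj_on subset_antisym)
  qed
  have h_bij: "bij_betw h (X - ?U) (X' - ?U')"
    using h by (simp add: perm_preserving_iff)
  have "bij_betw (\<lambda>x. if x \<in> ?U then u x else h x) (?U \<union> (X - ?U)) (?U' \<union> (X' - ?U'))"
    by (rule bij_betw_disjoint_Un[OF u h_bij]) auto
  moreover have "?U \<union> (X - ?U) = X" "?U' \<union> (X' - ?U') = X'"
    using src.chosen_points_subset tgt.chosen_points_subset by auto
  ultimately have "bij_betw f X X'"
    unfolding f_def bij_betw_restrict_eq by (simp only:)
  moreover have f_pt: "f (cycle_point \<sigma> c k i j) = cycle_point \<sigma>' c' k i (j + s k i)"
    if "k \<in> {1..n}" "i \<in> {1..p k}" for k i j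
    using that by (simp add: f_def src.cycle_point_in src.cycle_point_chosen u_pt)
  moreover have f_rest: "f x = h x" if "x \<in> X - ?U" for x
    using that by (simp add: f_def)
  moreover have "f (\<sigma> x) = \<sigma>' (f x)" if "x \<in> X" for x
  proof (cases "x \<in> ?U")
    case True
    then show ?thesis
      by (elim src.chosen_pointsE) (simp add: f_pt src.cycle_point_step tgt.cycle_point_step)
  next
    case False
    then have x: "x \<in> X - ?U" using that by simp
    then have "\<sigma> x \<in> X - ?U" "h x \<in> X' - ?U'"
      using src.rest_closed bij_betw_apply[OF h_bij] by blast+
    then show ?thesis
      using h x unfolding perm_preserving_iff
      by (simp add: f_rest perm_restrict_def)
  qed
  moreover have "\<exists>m<k. f (cycle_point \<sigma> c k i 0) = cycle_point \<sigma>' c' k i m"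
    if "k \<in> {1..n}" "i \<in> {1..p k}" for k i
    using s[OF that] f_pt[OF that, of 0] by auto
  moreover have "f \<in> extensional X"
    by (simp add: f_def)
  ultimately have f: "f \<in> homs"
    unfolding homs_iff perm_preserving_iff by blast
  moreover have "restrict f (X - ?U) = h"
    using h f_rest by (intro extensionalityI[of _ "X - ?U"]) (auto simp: perm_preserving_iff)
  moreover have "cycle_shift \<sigma> c \<sigma>' c' f k i = s k i" if "k \<in> {1..n}" "i \<in> {1..p k}" for k i
    using cycle_shift_eq[OF that, of f "s k i"] f_pt[OF that, of 0] s[OF that] by simp
  ultimately show thesis by (rule that)
qed

end


section \<open>Splitting off the chosen cycles\<close>

text \<open>The deloopings have the single object \<open>()\<close>, so the second object component
  is constant. The nested restricted functions match the extensional products of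
  \<open>Prod_cat\<close>, and \<open>int\<close> matches the carrier of
  \<open>integer_mod_group\<close>.\<close>

definition split_cycles :: "nat \<Rightarrow> (nat \<Rightarrow> nat) \<Rightarrow>
    ('a set \<times> ('a \<Rightarrow> 'a) \<times> (nat \<Rightarrow> 'a set list), 'a \<Rightarrow> 'a,
     ('a set \<times> ('a \<Rightarrow> 'a)) \<times> (nat \<Rightarrow> nat \<Rightarrow> unit), ('a \<Rightarrow> 'a) \<times> (nat \<Rightarrow> nat \<Rightarrow> int)) funct" where
  "split_cycles n p =
     \<lparr>FObj = (\<lambda>(X, \<sigma>, c).
        ((X - chosen_points n c, perm_restrict \<sigma> (X - chosen_points n c)),
         \<lambda>k\<in>{1..n}. \<lambda>i\<in>{1..p k}. ())),
      FMap = (\<lambda>(X, \<sigma>, c) (X', \<sigma>', c') f.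
        (restrict f (X - chosen_points n c),
         \<lambda>k\<in>{1..n}. \<lambda>i\<in>{1..p k}. int (cycle_shift \<sigma> c \<sigma>' c' f k i)))\<rparr>"

abbreviation split_groupoid :: "nat \<Rightarrow> (nat \<Rightarrow> nat) \<Rightarrow>
    (('a set \<times> ('a \<Rightarrow> 'a)) \<times> (nat \<Rightarrow> nat \<Rightarrow> unit), ('a \<Rightarrow> 'a) \<times> (nat \<Rightarrow> nat \<Rightarrow> int)) cat" where
  "split_groupoid n p \<equiv> prod_cat (Perm (int n - int (weight n p)))
     (Prod_cat {1..n} (\<lambda>k. power_cat (delooping (integer_mod_group k)) (p k)))"

lemma groupoid_split_groupoid: "is_groupoid (split_groupoid n p)"
  unfolding power_cat_def
  by (intro groupoid_prod_cat groupoid_Prod_cat groupoid_Perm groupoid_delooping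
      group_integer_mod_group)

text \<open>Since \<open>k\<close> ranges from 1, the exceptional group
  \<open>integer_mod_group 0\<close>, which is all of the integers, never occurs and each carrier is
  an interval.\<close>

lemma Hom_split_groupoid:
  "(h, s) \<in> Hom (split_groupoid n p) ((Y, \<rho>), u) ((Y', \<rho>'), u') \<longleftrightarrow>
    h \<in> perm_preserving Y \<rho> Y' \<rho>' \<and> s \<in> (\<Pi>\<^sub>E k\<in>{1..n}. {1..p k} \<rightarrow>\<^sub>E {0..<int k})"
proof -
  have "(\<Pi>\<^sub>E k\<in>{1..n}. {1..p k} \<rightarrow>\<^sub>E carrier (integer_mod_group k))
      = (\<Pi>\<^sub>E k\<in>{1..n}. {1..p k} \<rightarrow>\<^sub>E {0..<int k})"
    by (intro PiE_cong) (simp add: carrier_integer_mod_group)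
  then show ?thesis
    by (simp add: prod_cat_def Prod_cat_def power_cat_def delooping_def Perm_def)
qed

lemma functor_split_cycles:
  "is_functor (cycle_groupoid n p) (split_groupoid n p) (split_cycles n p)"
  unfolding is_functor_def
proof (intro conjI ballI, goal_cases)
  case (1 a)
  obtain X \<sigma> c where a: "a = (X, \<sigma>, c)" by (cases a)
  interpret marked_permutation n p X \<sigma> c
    using 1 a by (simp add: marked_permutationI)
  show ?case
    using card_rest perm_restrict_permutes finite
    by (simp add: a split_cycles_def prod_cat_def Perm_def Prod_cat_def power_cat_def delooping_def)
next
  case (2 a b f)
  obtain X \<sigma> c X' \<sigma>' c' where a: "a = (X, \<sigma>, c)" "b = (X', \<sigma>', c')"
    by (metis prod_cases3)
  interpret marked_permutation_pair n p X \<sigma> c X' \<sigma>' c'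
    using 2 a by (simp add: marked_permutationI marked_permutation_pair_def)
  have f: "f \<in> homs" using 2 a by simp
  show ?case
    using restrict_hom[OF f] cycle_shift_less[OF f]
    by (simp add: a split_cycles_def Hom_split_groupoid del: One_nat_def)
next
  case (3 a)
  obtain X \<sigma> c where a: "a = (X, \<sigma>, c)" by (cases a)
  interpret marked_permutation_pair n p X \<sigma> c X \<sigma> c
    using 3 a by (simp add: marked_permutationI marked_permutation_pair_def)
  \<comment> \<open>Source and target share their base points here, so the identity has shift
    zero.\<close>
  have "cycle_shift \<sigma> c \<sigma> c (\<lambda>x\<in>X. x) k i = 0" if "k \<in> {1..n}" "i \<in> {1..p k}" for k i
    using cycle_shift_eq[where m = 0 and f = "\<lambda>x\<in>X. x", OF that] src.cycle_point_in[OF that] by simp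
  moreover have "restrict (\<lambda>x\<in>X. x) (X - chosen_points n c) = (\<lambda>x\<in>X - chosen_points n c. x)"
    by (auto simp: fun_eq_iff)
  ultimately show ?case
    by (auto simp: a split_cycles_def cycle_groupoid_def prod_cat_def Prod_cat_def power_cat_def
        delooping_def Perm_def intro!: restrict_ext)
next
  case (4 a1 a2 a3 f g)
  obtain X \<sigma> c X' \<sigma>' c' X'' \<sigma>'' c''
    where a: "a1 = (X, \<sigma>, c)" "a2 = (X', \<sigma>', c')" "a3 = (X'', \<sigma>'', c'')"
    by (metis prod_cases3)
  interpret f: marked_permutation_pair n p X \<sigma> c X' \<sigma>' c'
    using 4 a by (simp add: marked_permutationI marked_permutation_pair_def)
  interpret g: marked_permutation_pair n p X' \<sigma>' c' X'' \<sigma>'' c''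
    using 4 a by (simp add: marked_permutationI marked_permutation_pair_def)
  interpret gf: marked_permutation_pair n p X \<sigma> c X'' \<sigma>'' c''
    using 4 a by (simp add: marked_permutationI marked_permutation_pair_def)
  have f: "f \<in> f.homs" and g: "g \<in> g.homs" using 4 a by simp_all
  have shift: "int (cycle_shift \<sigma> c \<sigma>'' c'' (compose X g f) k i) =
      (int (cycle_shift \<sigma>' c' \<sigma>'' c'' g k i) + int (cycle_shift \<sigma> c \<sigma>' c' f k i)) mod int k"
    if "k \<in> {1..n}" "i \<in> {1..p k}" for k i
  proof -
    \<comment> \<open>\<open>f\<close> takes the base point to the coordinate given by its shift,
      and \<open>g\<close> adds its own shift to that. Reducing the sum modulo \<open>k\<close> is
      the group law.\<close>
    have "compose X g f (cycle_point \<sigma> c k i 0) = cycle_point \<sigma>'' c'' k i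
        (cycle_shift \<sigma>' c' \<sigma>'' c'' g k i + cycle_shift \<sigma> c \<sigma>' c' f k i)"
      using f.src.cycle_point_in[OF that]
      by (simp add: compose_eq f.hom_cycle_point[OF f that] g.hom_cycle_point[OF g that] add.commute)
    from gf.cycle_shift_eq[where f = "compose X g f", OF that this] show ?thesis
      by (simp add: zmod_int)
  qed
  \<comment> \<open>\<open>f\<close> maps remaining points to remaining points, where
    \<open>g\<close> and its restriction agree.\<close>
  have "restrict (compose X g f) (X - chosen_points n c) =
      compose (X - chosen_points n c) (restrict g (X' - chosen_points n c'))
        (restrict f (X - chosen_points n c))"
    using f.restrict_hom[OF f] unfolding perm_preserving_iff
    by (auto simp: fun_eq_iff compose_def dest!: bij_betw_apply)
  with shift show ?case
    by (auto simp: a split_cycles_def cycle_groupoid_def prod_cat_def Prod_cat_def power_cat_def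
        delooping_def Perm_def intro!: restrict_ext)
qed

lemma fully_faithful_split_cycles:
  assumes "a \<in> Obj (cycle_groupoid n p)" "b \<in> Obj (cycle_groupoid n p)"
  shows "bij_betw (FMap (split_cycles n p) a b) (Hom (cycle_groupoid n p) a b)
    (Hom (split_groupoid n p) (FObj (split_cycles n p) a) (FObj (split_cycles n p) b))"
proof -
  obtain X \<sigma> c X' \<sigma>' c' where a: "a = (X, \<sigma>, c)" "b = (X', \<sigma>', c')"
    by (metis prod_cases3)
  interpret marked_permutation_pair n p X \<sigma> c X' \<sigma>' c'
    using assms a by (simp add: marked_permutationI marked_permutation_pair_def)
  let ?F = "FMap (split_cycles n p) a b"
    and ?D = "Hom (split_groupoid n p) (FObj (split_cycles n p) a) (FObj (split_cycles n p) b)"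
  have F: "?F f = (restrict f (X - chosen_points n c),
      \<lambda>k\<in>{1..n}. \<lambda>i\<in>{1..p k}. int (cycle_shift \<sigma> c \<sigma>' c' f k i))" for f
    by (simp add: split_cycles_def a)
  have "f = g" if f: "f \<in> homs" and g: "g \<in> homs" and eq: "?F f = ?F g" for f g
  proof (rule hom_eqI[OF f g])
    show "f x = g x" if "x \<in> X - chosen_points n c" for x
      using arg_cong[OF eq, of "\<lambda>w. fst w x"] that by (simp add: F)
    show "cycle_shift \<sigma> c \<sigma>' c' f k i = cycle_shift \<sigma> c \<sigma>' c' g k i"
      if "k \<in> {1..n}" "i \<in> {1..p k}" for k i
      using arg_cong[OF eq, of "\<lambda>w. snd w k i"] that by (simp add: F)
  qed
  moreover have "?F f \<in> ?D" if "f \<in> homs" for f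
    using functor_Hom[OF functor_split_cycles assms] that a by simp
  moreover have "w \<in> ?F ` homs" if w: "w \<in> ?D" for w
  proof -
    obtain h s where hs: "w = (h, s)" by (cases w)
    have h: "h \<in> perm_preserving (X - chosen_points n c) (perm_restrict \<sigma> (X - chosen_points n c))
          (X' - chosen_points n c') (perm_restrict \<sigma>' (X' - chosen_points n c'))"
      and s: "s \<in> (\<Pi>\<^sub>E k\<in>{1..n}. {1..p k} \<rightarrow>\<^sub>E {0..<int k})"
      using w by (simp_all add: a hs split_cycles_def Hom_split_groupoid del: One_nat_def)
    have s_ki: "s k i \<in> {0..<int k}" if "k \<in> {1..n}" "i \<in> {1..p k}" for k i
      by (rule PiE_mem[OF PiE_mem[OF s that(1)] that(2)])
    \<comment> \<open>Group elements are integers while shifts are natural numbers; nonnegativity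
      makes the conversion by \<open>nat\<close> lossless.\<close>
    then have "nat (s k i) < k" if "k \<in> {1..n}" "i \<in> {1..p k}" for k i
      using that by fastforce
    from hom_exists[where s = "\<lambda>k i. nat (s k i)", OF h this]
    obtain f where f: "f \<in> homs" "restrict f (X - chosen_points n c) = h"
      "\<And>k i. k \<in> {1..n} \<Longrightarrow> i \<in> {1..p k} \<Longrightarrow> cycle_shift \<sigma> c \<sigma>' c' f k i = nat (s k i)"
      by blast
    have "(\<lambda>k\<in>{1..n}. \<lambda>i\<in>{1..p k}. int (cycle_shift \<sigma> c \<sigma>' c' f k i)) = s"
    proof (rule extensionalityI)
      fix k assume k: "k \<in> {1..n}"
      have "(\<lambda>i\<in>{1..p k}. int (cycle_shift \<sigma> c \<sigma>' c' f k i)) = s k"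
        using PiE_mem[OF s k] f(3)[OF k] s_ki[OF k]
        by (intro extensionalityI[of _ "{1..p k}"]) (auto simp: PiE_iff)
      then show "(\<lambda>k\<in>{1..n}. \<lambda>i\<in>{1..p k}. int (cycle_shift \<sigma> c \<sigma>' c' f k i)) k = s k"
        using k by simp
    qed (use s in \<open>auto simp: PiE_iff\<close>)
    with f show ?thesis by (intro image_eqI[of _ _ f]) (simp_all add: F hs)
  qed
  ultimately show ?thesis
    unfolding bij_betw_def inj_on_def by (auto simp: a)
qed

text \<open>A preimage of a permutation of \<open>Y\<close> is obtained by adjoining a disjoint copy
  \<open>B\<close> of \<open>cycle_index n p\<close>, on which the residue coordinate is increased
  cyclically, and marking the resulting cycles.\<close>

lemma split_cycles_surj:
  "Obj (split_groupoid n p :: (('a::infinite set \<times> _) \<times> _, _) cat)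
    \<subseteq> FObj (split_cycles n p) ` Obj (cycle_groupoid n p)"
proof
  fix d :: "('a set \<times> ('a \<Rightarrow> 'a)) \<times> (nat \<Rightarrow> nat \<Rightarrow> unit)"
  assume "d \<in> Obj (split_groupoid n p)"
  then obtain Y \<tau> u where d: "d = ((Y, \<tau>), u)" and Y: "finite Y" "\<tau> permutes Y"
    "int (card Y) = int n - int (weight n p)"
    by (auto simp: prod_cat_def Perm_def)
  let ?T = "cycle_index n p"
  \<comment> \<open>The infinite universe is used here: it has \<open>weight n p\<close> elements
    outside the finite set \<open>Y\<close>.\<close>
  obtain B where B: "finite B" "card B = weight n p" "Y \<inter> B = {}"
    using finite_arbitrarily_large_disj[OF infinite_UNIV Y(1)] by blast
  obtain e where e: "bij_betw e ?T B"
    using finite_same_card_bij[OF finite_cycle_index B(1)] B(2) card_cycle_index by metis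
  \<comment> \<open>Adding one in every copy of Z/k; transported along \<open>e\<close>, this
    becomes the permutation of \<open>B\<close>.\<close>
  define next_index :: "nat \<times> nat \<times> nat \<Rightarrow> nat \<times> nat \<times> nat"
    where "next_index = (\<lambda>(k, i, j). (k, i, Suc j mod k))"
  have next_bij: "bij_betw next_index ?T ?T"
  proof -
    have "next_index ` ?T \<subseteq> ?T"
      by (auto simp: next_index_def cycle_index_iff)
    moreover have "inj_on next_index ?T"
      by (auto simp: inj_on_def next_index_def cycle_index_iff mod_Suc split: if_splits)
    ultimately show ?thesis
      using endo_inj_surj[OF finite_cycle_index] by (auto simp: bij_betw_def)
  qed
  define \<sigma> where "\<sigma> x = (if x \<in> B then e (next_index (inv_into ?T e x)) else \<tau> x)" for x
  define cyc where "cyc k i = (\<lambda>j. e (k, i, j)) ` {..<k}" for k i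
  define c where "c = (\<lambda>k\<in>{1..n}. map (\<lambda>m. cyc k (Suc m)) [0..<p k])"
  have \<sigma>_e: "\<sigma> (e (k, i, j)) = e (k, i, Suc j mod k)" if "(k, i, j) \<in> ?T" for k i j
    using that bij_betw_apply[OF e that]
    by (simp add: \<sigma>_def bij_betw_inv_into_left[OF e] next_index_def)
  have \<sigma>: "\<sigma> permutes (B \<union> Y)"
  proof (rule bij_imp_permutes)
    have "bij_betw (\<lambda>x. e (next_index (inv_into ?T e x))) B B"
      using bij_betw_trans[OF bij_betw_trans[OF bij_betw_inv_into[OF e] next_bij] e]
      by (simp add: comp_def)
    then show "bij_betw \<sigma> (B \<union> Y) (B \<union> Y)"
      unfolding \<sigma>_def using permutes_imp_bij[OF Y(2)] B(3)
      by (intro bij_betw_disjoint_Un) auto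
    show "\<sigma> x = x" if "x \<notin> B \<union> Y" for x
      using that Y(2) by (simp add: \<sigma>_def permutes_not_in)
  qed
  have orbit: "cyc k i = orbit \<sigma> (e (k, i, 0)) \<and> card (cyc k i) = k \<and> cyc k i \<subseteq> B"
    if ki: "k \<in> {1..n}" "i \<in> {1..p k}" for k i
  proof -
    have T: "(k, i, j) \<in> ?T" if "j < k" for j
      using that ki by (simp add: cycle_index_iff)
    have pow: "(\<sigma> ^^ j) (e (k, i, 0)) = e (k, i, j mod k)" for j
    proof (induction j)
      case (Suc j)
      have "j mod k < k" using ki by simp
      from \<sigma>_e[OF T[OF this]] Suc show ?case by (simp add: mod_Suc_eq)
    qed simp
    \<comment> \<open>The \<open>k\<close>-th iterate is back at the start, so the iterates below
      \<open>k\<close> exhaust the orbit.\<close>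
    have "orbit \<sigma> (e (k, i, 0)) = {(\<sigma> ^^ m) (e (k, i, 0)) | m. m < k}"
      using ki by (intro orbit_altdef_bounded) (simp_all add: pow)
    also have "\<dots> = cyc k i"
      by (auto simp: pow cyc_def) (metis mod_less)
    finally have "cyc k i = orbit \<sigma> (e (k, i, 0))" ..
    moreover have "inj_on (\<lambda>j. e (k, i, j)) {..<k}"
      using T bij_betw_imp_inj_on[OF e] by (auto simp: inj_on_def)
    then have "card (cyc k i) = k"
      by (simp add: cyc_def card_image)
    moreover have "cyc k i \<subseteq> B"
      using T bij_betw_apply[OF e] by (auto simp: cyc_def)
    ultimately show ?thesis by blast
  qed
  have cyc_eq: "i = i'"
    if eq: "cyc k i = cyc k i'" and "k \<in> {1..n}" "i \<in> {1..p k}" "i' \<in> {1..p k}" for k i i'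
  proof -
    \<comment> \<open>Cycles are nonempty because \<open>k\<close> is positive, so equal cycles
      share a point, and injectivity of \<open>e\<close> reads off its index
      \<open>i\<close>.\<close>
    have k: "0 < k" using that by simp
    then have "e (k, i, 0) \<in> cyc k i"
      unfolding cyc_def by blast
    then obtain j where j: "j < k" "e (k, i, 0) = e (k, i', j)"
      unfolding eq unfolding cyc_def by blast
    then have "(k, i, 0) = (k, i', j)"
      using that k by (intro inj_onD[OF bij_betw_imp_inj_on[OF e]]) (auto simp: cycle_index_iff)
    then show ?thesis by simp
  qed
  \<comment> \<open>The integer equation for \<open>card Y\<close> says that the sizes of
    \<open>Y\<close> and \<open>B\<close> add up to \<open>n\<close>.\<close>
  have "card (B \<union> Y) = n"
    using Y B card_Un_disjoint[of B Y] by (simp add: Int_commute)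
  moreover have "c \<in> (\<Pi>\<^sub>E k\<in>{1..n}. {cs. length cs = p k \<and> distinct cs \<and>
      set cs \<subseteq> cycles_of_length (B \<union> Y) \<sigma> k})"
  proof (rule PiE_I)
    fix k assume k: "k \<in> {1..n}"
    have "inj_on (\<lambda>m. cyc k (Suc m)) {..<p k}"
    proof (rule inj_onI)
      fix m m' assume "m \<in> {..<p k}" "m' \<in> {..<p k}" "cyc k (Suc m) = cyc k (Suc m')"
      then show "m = m'" using cyc_eq[of k "Suc m" "Suc m'"] k by simp
    qed
    then have "distinct (c k)"
      using k by (simp add: c_def distinct_map lessThan_atLeast0)
    moreover have "cyc k (Suc m) \<in> cycles_of_length (B \<union> Y) \<sigma> k" if "m < p k" for m
    proof -
      have i: "Suc m \<in> {1..p k}" using that by simp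
      have "e (k, Suc m, 0) \<in> B"
        using k i by (intro bij_betw_apply[OF e]) (simp add: cycle_index_iff)
      then show ?thesis
        using orbit[OF k i] by (auto simp: cycles_of_length_def)
    qed
    ultimately show "c k \<in> {cs. length cs = p k \<and> distinct cs \<and>
        set cs \<subseteq> cycles_of_length (B \<union> Y) \<sigma> k}"
      using k by (auto simp: c_def)
  qed (auto simp: c_def)
  ultimately have obj: "(B \<union> Y, \<sigma>, c) \<in> Obj (cycle_groupoid n p)"
    using Y(1) B(1) \<sigma> by (simp add: cycle_groupoid_def)
  have "chosen_points n c = B"
  proof
    show "chosen_points n c \<subseteq> B"
    proof
      fix x assume "x \<in> chosen_points n c"
      then obtain k C where k: "k \<in> {1..n}" "C \<in> set (c k)" "x \<in> C"
        unfolding chosen_points_def by blast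
      then obtain m where m: "m < p k" "C = cyc k (Suc m)"
        by (auto simp: c_def)
      then have "C \<subseteq> B"
        using orbit[OF k(1), of "Suc m"] by auto
      with k show "x \<in> B" by blast
    qed
    show "B \<subseteq> chosen_points n c"
    proof
      fix x assume "x \<in> B"
      then obtain k i j where "(k, i, j) \<in> ?T" "x = e (k, i, j)"
        using bij_betw_imp_surj_on[OF e] by (metis imageE prod_cases3)
      then have ki: "k \<in> {1..n}" "i \<in> {1..p k}" and x: "x \<in> cyc k i"
        by (auto simp: cycle_index_iff cyc_def)
      then have "cyc k i \<in> set (c k)"
        by (auto simp: c_def intro!: image_eqI[of _ _ "i - 1"])
      with ki x show "x \<in> chosen_points n c"
        unfolding chosen_points_def by blast
    qed
  qed
  then have rest: "B \<union> Y - chosen_points n c = Y"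
    using B(3) by auto
  \<comment> \<open>On \<open>Y\<close>, which is disjoint from \<open>B\<close>, \<sigma> was
    defined as \<tau>; off \<open>Y\<close> both sides are the identity.\<close>
  have "perm_restrict \<sigma> Y = \<tau>"
    using B(3) Y(2) by (auto simp: fun_eq_iff perm_restrict_def \<sigma>_def permutes_not_in)
  \<comment> \<open>Any two functions with values in \<open>unit\<close> are equal, which settles
    the component \<open>u\<close>.\<close>
  then have "FObj (split_cycles n p) (B \<union> Y, \<sigma>, c) = d"
    by (simp add: split_cycles_def rest d) (simp add: fun_eq_iff)
  with obj show "d \<in> FObj (split_cycles n p) ` Obj (cycle_groupoid n p)"
    by (metis image_eqI)
qed

theorem theorem3:
  fixes n :: nat and p :: "nat \<Rightarrow> nat"
  shows "equivalent_groupoids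
    (cycle_groupoid n p ::
       ('a::infinite set \<times> ('a \<Rightarrow> 'a) \<times> (nat \<Rightarrow> 'a set list), 'a \<Rightarrow> 'a) cat)
    (prod_cat
       (Perm (int n - int (weight n p)) :: ('a set \<times> ('a \<Rightarrow> 'a), 'a \<Rightarrow> 'a) cat)
       (Prod_cat {1..n} (\<lambda>k. power_cat (delooping (integer_mod_group k)) (p k))))"
  by (rule equivalent_groupoidsI[OF groupoid_cycle_groupoid groupoid_split_groupoid
        functor_split_cycles fully_faithful_split_cycles split_cycles_surj])

end
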